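(* Let $G$ be a finite graph without multiple edges and with at most one loop at each vertex, and let $q:D(G)\to\mathbb{H}\setminus\{0\}$ satisfy $\sum_{e\in D(G),\,o(e)=u}|q(e)|^2=1$ for every $u\in V(G)$. Let $\mathbf{U}$, $\tilde{\mathbf{W}}$, $\mathbf{L}$, $\mathbf{J}_0$ be the matrices determined by $G$ and $q$ as defined in the context. Suppose that $\mathbf{v}\in\mathbb{H}^{V(G)}$ is a right eigenvector corresponding to a complex right eigenvalue $\mu$ of $\tilde{\mathbf{W}}$, namely $\tilde{\mathbf{W}}\mathbf{v}=\mathbf{v}\mu$. Then the vector $$\mathbf{e}=\mathbf{J}_0\mathbf{L}\mathbf{v}-\mathbf{L}\mathbf{v}\,\frac{1}{\lambda}\ \in\ \mathbb{H}^{D(G)}$$ is a right eigenvector of $\mathbf{U}$ corresponding to the complex right eigenvalue $\lambda$, where $\mu$ and $\lambda$ satisfy $\mu=\lambda+\frac{1}{\lambda}$.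
   Context: $\mathbb{H}$ denotes the real quaternions, $x^*$ the quaternionic conjugate of $x$, $|x|=\sqrt{xx^*}$; complex numbers are regarded as the quaternions $x_0+x_1i$. $\mathbb{H}^{V(G)}$ and $\mathbb{H}^{D(G)}$ (column vectors indexed by vertices, resp. arcs) are right $\mathbb{H}$-vector spaces: scalars multiply on the right, matrices act on the left. A quaternion $\lambda$ is a right eigenvalue of a square quaternionic matrix $\mathbf{M}$, with right eigenvector $\mathbf{v}\neq 0$, if $\mathbf{M}\mathbf{v}=\mathbf{v}\lambda$. $V(G)$ is the vertex set of $G$. Arcs: for each unoriented edge $uv$ of $G$, the ordered pairs $(u,v)$ and $(v,u)$ are arcs; $D(G)$ is the set of all arcs. For $e=(u,v)$, $o(e)=u$ is its origin, $t(e)=v$ its terminus, $e^{-1}=(v,u)$. A loop at $u$ gives exactly one arc $(u,u)$, so $e^{-1}=e$ if and only if $e$ is a loop. $\mathbf{U}=(\mathbf{U}_{ef})_{e,f\in D(G)}$ (transition matrix of the quaternionic Szegedy walk): $\mathbf{U}_{ef}=2q(e)q(f^{-1})^*$ if $t(f)=o(e)$ and $f\ne e^{-1}$; $\mathbf{U}_{ef}=2|q(e)|^2-1$ if $f=e^{-1}$; $0$ otherwise. $\tilde{\mathbf{W}}=(\tilde{\mathbf{W}}_{uv})_{u,v\in V(G)}$ (doubly weighted matrix): $\tilde{\mathbf{W}}_{uv}=2q((u,v))^*q((v,u))$ if $(v,u)\in D(G)$, and $0$ otherwise. $\mathbf{L}=(\mathbf{L}_{ev})_{e\in D(G),v\in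 V(G)}$: $\mathbf{L}_{ev}=\sqrt{2}\,q(e^{-1})$ if $t(e)=v$, and $0$ otherwise. $\mathbf{J}_0$ is indexed by $D(G)\times D(G)$, with $(e,f)$ entry $1$ if $f=e^{-1}$ and $0$ otherwise.
   Formalization: That e is nonzero, hence a right eigenvector, is claimed only for λ ≠ 1 and λ ≠ −1, because e is always zero when λ = ±1 (e.g. one vertex, one loop, q = 1, v = 1, λ = 1); the equation Ue = eλ is proved for every nonzero λ. *)

theory Defs
  imports "HOL-Analysis.Analysis"
begin

section \<open>The real quaternions\<close>

datatype quat = Quat (QRe: real) (QIm1: real) (QIm2: real) (QIm3: real)

instantiation quat :: real_normed_div_algebra
begin

definition "0 = Quat 0 0 0 0"
definition "1 = Quat 1 0 0 0"
definition "x + y = Quat (QRe x + QRe y) (QIm1 x + QIm1 y) (QIm2 x + QIm2 y) (QIm3 x + QIm3 y)"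
definition "x - y = Quat (QRe x - QRe y) (QIm1 x - QIm1 y) (QIm2 x - QIm2 y) (QIm3 x - QIm3 y)"
definition "- x = Quat (- QRe x) (- QIm1 x) (- QIm2 x) (- QIm3 x)"
definition "r *\<^sub>R x = Quat (r * QRe x) (r * QIm1 x) (r * QIm2 x) (r * QIm3 x)"

definition "x * y = Quat
  (QRe x * QRe y - QIm1 x * QIm1 y - QIm2 x * QIm2 y - QIm3 x * QIm3 y)
  (QRe x * QIm1 y + QIm1 x * QRe y + QIm2 x * QIm3 y - QIm3 x * QIm2 y)
  (QRe x * QIm2 y - QIm1 x * QIm3 y + QIm2 x * QRe y + QIm3 x * QIm1 y)
  (QRe x * QIm3 y + QIm1 x * QIm2 y - QIm2 x * QIm1 y + QIm3 x * QRe y)"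

definition "norm x = sqrt ((QRe x)\<^sup>2 + (QIm1 x)\<^sup>2 + (QIm2 x)\<^sup>2 + (QIm3 x)\<^sup>2)"

definition "inverse x =
  inverse ((norm x)\<^sup>2) *\<^sub>R Quat (QRe x) (- QIm1 x) (- QIm2 x) (- QIm3 x)"
definition "x div y = x * inverse y" for x y :: quat

definition "sgn x = inverse (norm x) *\<^sub>R x" for x :: quat
definition "dist x y = norm (x - y)" for x y :: quat
definition "uniformity = (INF e\<in>{0<..}. principal {(x :: quat, y). dist x y < e})"
definition "open S \<longleftrightarrow> (\<forall>x\<in>S. \<forall>\<^sub>F (x', y) in uniformity. x' = x \<longrightarrow> y \<in> S)" for S :: "quat set"

lemmas quat_ops = zero_quat_def one_quat_def plus_quat_def minus_quat_def uminus_quat_def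
  scaleR_quat_def times_quat_def

lemma norm_quat_sq: "(norm x)\<^sup>2 = (QRe x)\<^sup>2 + (QIm1 x)\<^sup>2 + (QIm2 x)\<^sup>2 + (QIm3 x)\<^sup>2" for x :: quat
  by (simp add: norm_quat_def)

lemma norm_quat_prod: "norm x = norm (QRe x, QIm1 x, QIm2 x, QIm3 x)" for x :: quat
  by (simp add: norm_quat_def norm_prod_def add.assoc)

lemma norm_quat_zero: "norm x = 0 \<longleftrightarrow> x = 0" for x :: quat
  by (cases x) (simp add: norm_quat_prod quat_ops zero_prod_def)

lemma norm_quat_triangle: "norm (x + y) \<le> norm x + norm y" for x y :: quat
  using norm_triangle_ineq [of "(QRe x, QIm1 x, QIm2 x, QIm3 x)" "(QRe y, QIm1 y, QIm2 y, QIm3 y)"]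
  by (simp add: norm_quat_prod plus_quat_def)

lemma norm_quat_mult: "norm (x * y) = norm x * norm y" for x y :: quat
proof (rule power2_eq_imp_eq)
  show "(norm (x * y))\<^sup>2 = (norm x * norm y)\<^sup>2"
    unfolding power_mult_distrib norm_quat_sq
    by (simp add: quat_ops) (simp add: power2_eq_square algebra_simps)
qed (simp_all add: norm_quat_def)

lemma quat_inverse:
  fixes x :: quat
  assumes "x \<noteq> 0"
  shows "inverse x * x = 1" "x * inverse x = 1"
proof -
  define c where "c = inverse ((norm x)\<^sup>2)"
  have "(norm x)\<^sup>2 \<noteq> 0" using assms norm_quat_zero by simp
  then have c: "c * ((QRe x)\<^sup>2 + (QIm1 x)\<^sup>2 + (QIm2 x)\<^sup>2 + (QIm3 x)\<^sup>2) = 1"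
    by (simp add: c_def norm_quat_sq)
  have inv: "inverse x = c *\<^sub>R Quat (QRe x) (- QIm1 x) (- QIm2 x) (- QIm3 x)"
    by (simp add: inverse_quat_def c_def)
  show "inverse x * x = 1" "x * inverse x = 1"
    using c unfolding inv by (simp_all add: quat_ops power2_eq_square algebra_simps)
qed

instance
proof
  fix x y z :: quat and r s :: real
  show "x + y + z = x + (y + z)" "x + y = y + x" "0 + x = x" "- x + x = 0" "x - y = x + - y"
    "1 * x = x" "x * 1 = x" "r *\<^sub>R (x + y) = r *\<^sub>R x + r *\<^sub>R y" "(r + s) *\<^sub>R x = r *\<^sub>R x + s *\<^sub>R x"
    "r *\<^sub>R s *\<^sub>R x = (r * s) *\<^sub>R x" "1 *\<^sub>R x = x" "x * y * z = x * (y * z)"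
    "(x + y) * z = x * z + y * z" "x * (y + z) = x * y + x * z"
    "r *\<^sub>R x * y = r *\<^sub>R (x * y)" "x * r *\<^sub>R y = r *\<^sub>R (x * y)"
    by (simp_all add: quat_ops algebra_simps)
  show "(0 :: quat) \<noteq> 1" by (simp add: quat_ops)
  show "inverse (0 :: quat) = 0" by (simp add: inverse_quat_def norm_quat_def quat_ops)
  show "norm (r *\<^sub>R x) = \<bar>r\<bar> * norm x"
  proof (rule power2_eq_imp_eq)
    show "(norm (r *\<^sub>R x))\<^sup>2 = (\<bar>r\<bar> * norm x)\<^sup>2"
      unfolding power_mult_distrib norm_quat_sq
      by (simp add: quat_ops power_mult_distrib algebra_simps)
  qed (simp_all add: norm_quat_def)
qed (fact divide_quat_def sgn_quat_def dist_quat_def uniformity_quat_def open_quat_def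
    norm_quat_zero norm_quat_triangle norm_quat_mult quat_inverse)+

end

definition qcnj :: "quat \<Rightarrow> quat" where
  "qcnj x = Quat (QRe x) (- QIm1 x) (- QIm2 x) (- QIm3 x)"

lemma quat_mult_qcnj: "x * qcnj x = of_real ((norm x)\<^sup>2)"
  by (simp add: qcnj_def norm_quat_sq of_real_def quat_ops) (simp add: power2_eq_square)

definition quat_of_complex :: "complex \<Rightarrow> quat" where
  "quat_of_complex z = Quat (Re z) (Im z) 0 0"


section \<open>Quaternionic matrices over finite index sets\<close>

text \<open>
  Vectors and matrices are functions of which only the values on the index sets matter.
  Matrices act on the left, scalars on the right.
\<close>

definition mat_vec :: "'j set \<Rightarrow> ('i \<Rightarrow> 'j \<Rightarrow> quat) \<Rightarrow> ('j \<Rightarrow> quat) \<Rightarrow> 'i \<Rightarrow> quat" where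
  "mat_vec J M x = (\<lambda>i. \<Sum>j\<in>J. M i j * x j)"

definition right_eigenvector :: "'i set \<Rightarrow> ('i \<Rightarrow> 'i \<Rightarrow> quat) \<Rightarrow> ('i \<Rightarrow> quat) \<Rightarrow> quat \<Rightarrow> bool" where
  "right_eigenvector I M x l \<longleftrightarrow>
     (\<exists>i\<in>I. x i \<noteq> 0) \<and> (\<forall>i\<in>I. mat_vec I M x i = x i * l)"


section \<open>Graphs and the matrices of the quaternionic Szegedy walk\<close>

text \<open>
  An edge is the set of its endpoints, so multiple edges cannot occur; a loop is a singleton.
\<close>

definition finite_graph :: "'v set \<Rightarrow> 'v set set \<Rightarrow> bool" where
  "finite_graph V E \<longleftrightarrow> finite V \<and> (\<forall>d\<in>E. \<exists>u\<in>V. \<exists>w\<in>V. d = {u, w})"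

definition arcs :: "'v set set \<Rightarrow> ('v \<times> 'v) set" where
  "arcs E = {(u, w). {u, w} \<in> E}"

abbreviation origin :: "'v \<times> 'v \<Rightarrow> 'v" where
  "origin \<equiv> fst"

abbreviation terminus :: "'v \<times> 'v \<Rightarrow> 'v" where
  "terminus \<equiv> snd"

abbreviation inv_arc :: "'v \<times> 'v \<Rightarrow> 'v \<times> 'v" where
  "inv_arc \<equiv> prod.swap"

text \<open>
  The arc \<open>inv_arc e\<close> also terminates at \<open>origin e\<close>, so its case comes first. If \<open>e\<close> is a loop,
  it is its own inverse and this case gives the diagonal entry.
\<close>

definition U_mat :: "('v \<times> 'v \<Rightarrow> quat) \<Rightarrow> 'v \<times> 'v \<Rightarrow> 'v \<times> 'v \<Rightarrow> quat" where
  "U_mat q e f =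
     (if f = inv_arc e then of_real (2 * (norm (q e))\<^sup>2 - 1)
      else if terminus f = origin e then 2 * q e * qcnj (q (inv_arc f))
      else 0)"

definition W_mat :: "'v set set \<Rightarrow> ('v \<times> 'v \<Rightarrow> quat) \<Rightarrow> 'v \<Rightarrow> 'v \<Rightarrow> quat" where
  "W_mat E q u w = (if (w, u) \<in> arcs E then 2 * qcnj (q (u, w)) * q (w, u) else 0)"

definition L_mat :: "('v \<times> 'v \<Rightarrow> quat) \<Rightarrow> 'v \<times> 'v \<Rightarrow> 'v \<Rightarrow> quat" where
  "L_mat q e w = (if terminus e = w then of_real (sqrt 2) * q (inv_arc e) else 0)"

definition J0_mat :: "'v \<times> 'v \<Rightarrow> 'v \<times> 'v \<Rightarrow> quat" where
  "J0_mat e f = (if f = inv_arc e then 1 else 0)"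

end

theory Submission
  imports Defs
begin

text \<open>
  Write \<open>X a = q a * v (origin a)\<close>. Up to the factor \<open>sqrt 2\<close>, the vector \<open>e\<close> has the entries
  \<open>X a - X (inv_arc a) * (1 / lam)\<close>. On arbitrary vectors the walk is a rank-one reflection at each
  vertex composed with the arc reversal,
  \<open>(U x) a = 2 * q a * S (origin a) - x (inv_arc a)\<close> with
  \<open>S u = (\<Sum>f | terminus f = u. qcnj (q (inv_arc f)) * x f)\<close>, and for \<open>x = e\<close> the eigenvalue
  equation of \<open>W\<close> and the normalisation of \<open>q\<close> give \<open>2 * S u = sqrt 2 * v u * (lam - 1 / lam)\<close>.
  If \<open>e\<close> vanished, comparing its entries at \<open>a\<close> and at \<open>inv_arc a\<close> would give
  \<open>X a = X a * (1 / lam)\<^sup>2\<close>, so that \<open>lam\<^sup>2 = 1\<close> or \<open>v = 0\<close>.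
\<close>

lemma quat_of_complex_add: "quat_of_complex (x + y) = quat_of_complex x + quat_of_complex y"
  by (simp add: quat_of_complex_def quat_ops)

lemma quat_of_complex_mult: "quat_of_complex (x * y) = quat_of_complex x * quat_of_complex y"
  by (simp add: quat_of_complex_def quat_ops)

lemma quat_of_complex_1 [simp]: "quat_of_complex 1 = 1"
  by (simp add: quat_of_complex_def quat_ops)

lemma quat_of_complex_eq_iff [simp]: "quat_of_complex x = quat_of_complex y \<longleftrightarrow> x = y"
  by (auto simp: quat_of_complex_def complex_eq_iff)

lemma qcnj_mult_self: "qcnj x * x = of_real ((norm x)\<^sup>2)"
  by (simp add: qcnj_def norm_quat_sq of_real_def quat_ops) (simp add: power2_eq_square)

lemma swap_in_arcs_iff [simp]: "prod.swap a \<in> arcs E \<longleftrightarrow> a \<in> arcs E"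
  by (cases a) (simp add: arcs_def insert_commute)

lemma arcs_subset_Times: "finite_graph V E \<Longrightarrow> arcs E \<subseteq> V \<times> V"
  unfolding finite_graph_def arcs_def by (fastforce simp: doubleton_eq_iff)

lemma finite_arcs: "finite_graph V E \<Longrightarrow> finite (arcs E)"
  by (rule finite_subset[OF arcs_subset_Times]) (auto simp: finite_graph_def)

text \<open>Reversal carries the normalisation, given for arcs leaving a vertex, over to the arcs
  entering it, over which \<open>U\<close> and \<open>W\<close> sum.\<close>

lemma sum_arcs_swap:
  "(\<Sum>f\<in>{f \<in> arcs E. terminus f = u}. h (inv_arc f)) = (\<Sum>f\<in>{f \<in> arcs E. origin f = u}. h f)"
  by (rule sum.reindex_bij_witness[of _ prod.swap prod.swap]) auto

lemma mat_vec_L: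
  assumes "finite_graph V E" "a \<in> arcs E"
  shows "mat_vec V (L_mat q) v a = of_real (sqrt 2) * (q (inv_arc a) * v (terminus a))"
proof -
  have "finite V" "terminus a \<in> V"
    using assms arcs_subset_Times[of V E] by (auto simp: finite_graph_def)
  then show ?thesis
    by (simp add: mat_vec_def L_mat_def if_distrib[of "\<lambda>x. x * _"] mult.assoc cong: if_cong)
qed

lemma mat_vec_J0:
  assumes "finite (arcs E)" "a \<in> arcs E"
  shows "mat_vec (arcs E) J0_mat x a = x (inv_arc a)"
  using assms by (simp add: mat_vec_def J0_mat_def if_distrib[of "\<lambda>x. x * _"] cong: if_cong)

text \<open>There is at most one arc from \<open>w\<close> to \<open>u\<close>, so \<open>w\<close>
  and \<open>(w, u)\<close> correspond bijectively; the sum over neighbours becomes the sum over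
  incoming arcs that also occurs in \<open>U\<close>.\<close>

lemma mat_vec_W:
  assumes "finite_graph V E"
  shows "mat_vec V (W_mat E q) v u =
    2 * (\<Sum>f\<in>{f \<in> arcs E. terminus f = u}. qcnj (q (inv_arc f)) * (q f * v (origin f)))"
proof -
  have "finite V" using assms by (simp add: finite_graph_def)
  have "mat_vec V (W_mat E q) v u =
      (\<Sum>w\<in>{w \<in> V. (w, u) \<in> arcs E}. 2 * (qcnj (q (u, w)) * (q (w, u) * v w)))"
    unfolding mat_vec_def W_mat_def
    by (rule sum.mono_neutral_cong_right) (auto simp: \<open>finite V\<close> mult.assoc)
  also have "\<dots> = (\<Sum>f\<in>{f \<in> arcs E. terminus f = u}.
      2 * (qcnj (q (inv_arc f)) * (q f * v (origin f))))"
    using arcs_subset_Times[OF assms]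
    by (intro sum.reindex_bij_witness[of _ fst "\<lambda>w. (w, u)"]) auto
  finally show ?thesis by (simp add: sum_distrib_left)
qed

text \<open>At \<open>f = inv_arc a\<close> the generic entry would be
  \<open>2 * q a * qcnj (q a)\<close>, which is twice the squared norm of \<open>q a\<close>; the
  true entry is smaller by 1. Hence \<open>U\<close> is the generic matrix minus
  \<open>J0_mat\<close>.\<close>

lemma mat_vec_U:
  assumes "finite (arcs E)" "a \<in> arcs E"
  shows "mat_vec (arcs E) (U_mat q) x a =
    q a * (2 * (\<Sum>f\<in>{f \<in> arcs E. terminus f = origin a}. qcnj (q (inv_arc f)) * x f))
    - x (inv_arc a)"
proof -
  let ?g = "\<lambda>f. q a * (2 * (qcnj (q (inv_arc f)) * x f))"
  have two: "y * (2 * z) = 2 * (y * z)" for y z :: quat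
    by (simp only: mult_2 distrib_left)
  have "U_mat q a f * x f =
      (if terminus f = origin a then ?g f else 0) - (if f = inv_arc a then x f else 0)" for f
  proof (cases "f = inv_arc a")
    case True
    have "?g f = 2 * (q a * qcnj (q a)) * x f"
      using True by (simp only: two swap_swap mult.assoc)
    then have "?g f = of_real (2 * (norm (q a))\<^sup>2) * x f"
      by (simp add: quat_mult_qcnj)
    moreover have "terminus f = origin a" using True by simp
    ultimately show ?thesis
      using True by (simp only: U_mat_def simp_thms if_True of_real_diff of_real_1 left_diff_distrib mult_1_left)
  qed (simp add: U_mat_def two mult.assoc)
  then have "mat_vec (arcs E) (U_mat q) x a =
      (\<Sum>f\<in>arcs E. if terminus f = origin a then ?g f else 0) - x (inv_arc a)"
    using assms by (simp add: mat_vec_def sum_subtractf)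
  also have "(\<Sum>f\<in>arcs E. if terminus f = origin a then ?g f else 0) =
      (\<Sum>f\<in>{f \<in> arcs E. terminus f = origin a}. ?g f)"
    using assms by (simp add: sum.inter_filter)
  finally show ?thesis by (simp add: sum_distrib_left)
qed

text \<open>The eigenvalue equation holds for every nonzero \<open>lam\<close>, but at
  \<open>lam = 1\<close> or \<open>lam = - 1\<close> the vector may vanish: a single loop with
  \<open>q = 1\<close> and \<open>v = 1\<close> has \<open>mu = 2\<close>, \<open>lam = 1\<close>
  and \<open>e = 0\<close>.\<close>

theorem theorem6p2:
  fixes V :: "'v set" and E :: "'v set set"
    and q :: "'v \<times> 'v \<Rightarrow> quat"
    and v :: "'v \<Rightarrow> quat" and mu lam :: complex
  assumes "finite_graph V E"
    and "\<forall>a\<in>arcs E. q a \<noteq> 0"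
    and "\<forall>u\<in>V. (\<Sum>a\<in>{a \<in> arcs E. origin a = u}. (norm (q a))\<^sup>2) = 1"
    and "right_eigenvector V (W_mat E q) v (quat_of_complex mu)"
    and "lam \<noteq> 0"
    and "mu = lam + 1 / lam"
  shows "let D = arcs E;
             Lv = mat_vec V (L_mat q) v;
             e = (\<lambda>a. mat_vec D J0_mat Lv a - Lv a * quat_of_complex (1 / lam))
         in (\<forall>a\<in>D. mat_vec D (U_mat q) e a = e a * quat_of_complex lam) \<and>
            (lam \<noteq> 1 \<and> lam \<noteq> - 1 \<longrightarrow> right_eigenvector D (U_mat q) e (quat_of_complex lam))"
proof -
  define D where "D = arcs E"
  define Lv where "Lv = mat_vec V (L_mat q) v"
  define e where "e = (\<lambda>a. mat_vec D J0_mat Lv a - Lv a * quat_of_complex (1 / lam))"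
  define l where "l = quat_of_complex lam"
  define k where "k = quat_of_complex (1 / lam)"
  define s where "s = (of_real (sqrt 2) :: quat)"
  define X where "X = (\<lambda>a. q a * v (origin a))"
  have fin: "finite (arcs E)" using assms(1) by (rule finite_arcs)
  have kl: "k * l = 1"
    using assms(5) by (simp add: k_def l_def flip: quat_of_complex_mult)
  have W: "mat_vec V (W_mat E q) v u = v u * (l + k)" if "u \<in> V" for u
    using assms(4,6) that
    by (simp add: right_eigenvector_def l_def k_def quat_of_complex_add)
  have e: "e a = s * (X a - X (inv_arc a) * k)" if "a \<in> D" for a
    using that fin assms(1)
    by (simp add: e_def Lv_def D_def mat_vec_J0 mat_vec_L X_def s_def k_def
        right_diff_distrib mult.assoc)
  \<comment> \<open>Being real, \<open>s\<close> is central. The quaternions \<open>l\<close> and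
    \<open>k\<close> need not commute with \<open>q\<close> or \<open>v\<close> and stay on the
    right throughout.\<close>
  have s_comm: "x * s = s * x" for x
    by (simp add: s_def of_real_def)
  have S: "2 * (\<Sum>f\<in>{f \<in> arcs E. terminus f = u}. qcnj (q (inv_arc f)) * e f) = s * (v u * (l - k))"
    if "u \<in> V" for u
  proof -
    let ?T = "{f \<in> arcs E. terminus f = u}"
    have "(\<Sum>f\<in>?T. qcnj (q (inv_arc f)) * e f) =
        (\<Sum>f\<in>?T. s * (qcnj (q (inv_arc f)) * (q f * v (origin f)))
          - s * (of_real ((norm (q (inv_arc f)))\<^sup>2) * (v u * k)))"
    proof (rule sum.cong[OF refl])
      fix f assume f: "f \<in> ?T"
      let ?c = "qcnj (q (inv_arc f))"
      have "?c * e f = s * (?c * (X f - X (inv_arc f) * k))"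
        using f e[of f] s_comm[of ?c] by (simp add: D_def flip: mult.assoc)
      \<comment> \<open>Since \<open>f\<close> ends at \<open>u\<close>,
        \<open>X (inv_arc f)\<close> is \<open>q (inv_arc f) * v u\<close>, whose second factor does
        not depend on \<open>f\<close>.\<close>
      also have "\<dots> = s * (?c * X f) - s * (?c * q (inv_arc f) * (v u * k))"
        using f by (simp add: X_def right_diff_distrib mult.assoc)
      finally show "?c * e f = s * (?c * (q f * v (origin f)))
          - s * (of_real ((norm (q (inv_arc f)))\<^sup>2) * (v u * k))"
        by (simp add: qcnj_mult_self X_def)
    qed
    also have "\<dots> = s * (\<Sum>f\<in>?T. qcnj (q (inv_arc f)) * (q f * v (origin f)))
        - s * (of_real (\<Sum>f\<in>?T. (norm (q (inv_arc f)))\<^sup>2) * (v u * k))"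
      by (simp only: sum_subtractf sum_distrib_left sum_distrib_right of_real_sum)
    also have "(\<Sum>f\<in>?T. (norm (q (inv_arc f)))\<^sup>2) = 1"
      using assms(3) that by (simp add: sum_arcs_swap[where h = "\<lambda>f. (norm (q f))\<^sup>2"])
    finally have "(\<Sum>f\<in>?T. qcnj (q (inv_arc f)) * e f) =
        s * (\<Sum>f\<in>?T. qcnj (q (inv_arc f)) * (q f * v (origin f))) - s * (v u * k)"
      by simp
    then have "2 * (\<Sum>f\<in>?T. qcnj (q (inv_arc f)) * e f) =
        s * mat_vec V (W_mat E q) v u - 2 * (s * (v u * k))"
      by (simp only: mat_vec_W[OF assms(1)]) (simp add: algebra_simps mult_2 mult_2_right)
    \<comment> \<open>The eigenvalue of \<open>W\<close> is \<open>l + k\<close>, and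
      \<open>(l + k) - 2 * k = l - k\<close>.\<close>
    also have "\<dots> = s * (v u * (l - k))"
      unfolding W[OF that] by (simp add: algebra_simps mult_2)
    finally show ?thesis .
  qed
  have eig: "mat_vec D (U_mat q) e a = e a * l" if a: "a \<in> D" for a
  proof -
    have "origin a \<in> V"
      using a arcs_subset_Times[OF assms(1)] by (auto simp: D_def)
    then have "mat_vec D (U_mat q) e a = q a * (s * (v (origin a) * (l - k))) - e (inv_arc a)"
      using S[of "origin a"] a fin
      by (simp add: D_def mat_vec_U)
    also have "q a * (s * (v (origin a) * (l - k))) = s * (X a * (l - k))"
      using s_comm[of "q a"] by (simp add: X_def flip: mult.assoc)
    \<comment> \<open>The term \<open>- X a * k\<close> of the reflection cancels against the one in
      \<open>e (inv_arc a)\<close>.\<close>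
    also have "\<dots> - e (inv_arc a) = s * (X a * l - X (inv_arc a))"
      using a e[of "inv_arc a"] by (simp add: D_def algebra_simps)
    also have "\<dots> = e a * l"
      by (simp only: e[OF a] mult.assoc left_diff_distrib kl mult_1_right)
    finally show ?thesis .
  qed
  have "\<exists>a\<in>D. e a \<noteq> 0" if "lam \<noteq> 1" "lam \<noteq> - 1"
  proof (rule ccontr)
    assume "\<not> ?thesis"
    then have "e a = 0" if "a \<in> D" for a using that by blast
    then have X: "X a = X (inv_arc a) * k" if "a \<in> D" for a
      using that e[OF that] by (simp add: s_def)
    have "(1 / lam) * (1 / lam) \<noteq> 1"
      using that assms(5) by (simp add: field_simps square_eq_1_iff)
    then have kk: "k * k \<noteq> 1"
      unfolding k_def quat_of_complex_mult[symmetric] quat_of_complex_1[symmetric]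
        quat_of_complex_eq_iff .
    have X0: "X a = 0" if "a \<in> D" for a
    proof -
      have "inv_arc a \<in> D" using that by (simp add: D_def)
      from X[OF this] have X': "X (inv_arc a) = X a * k" unfolding swap_swap .
      have "X a * (1 - k * k) = X a - X (inv_arc a) * k"
        by (simp add: X' right_diff_distrib mult.assoc)
      also have "\<dots> = 0" unfolding X[OF that, symmetric] by simp
      finally have "X a * (1 - k * k) = 0" .
      with kk show ?thesis by (metis eq_iff_diff_eq_0 mult_eq_0_iff)
    qed
    have "v u = 0" if u: "u \<in> V" for u
    proof -
      \<comment> \<open>An isolated vertex would make the normalising sum empty, hence 0 instead of
        1. So some arc leaves \<open>u\<close>, and its nonzero weight can be cancelled from
        \<open>X a = 0\<close>.\<close>
      have "{a \<in> arcs E. origin a = u} \<noteq> {}"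
      proof
        assume "{a \<in> arcs E. origin a = u} = {}"
        from bspec[OF assms(3) u, unfolded this] show False by simp
      qed
      then obtain a where "a \<in> D" "origin a = u" by (auto simp: D_def)
      with X0[of a] assms(2) show ?thesis by (auto simp: X_def D_def)
    qed
    with assms(4) show False by (auto simp: right_eigenvector_def)
  qed
  with eig have "(\<forall>a\<in>D. mat_vec D (U_mat q) e a = e a * l) \<and>
      (lam \<noteq> 1 \<and> lam \<noteq> - 1 \<longrightarrow> right_eigenvector D (U_mat q) e l)"
    by (simp only: right_eigenvector_def) blast
  then show ?thesis
    unfolding Let_def e_def l_def Lv_def D_def .
qed

end
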